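(* Let a circle $\mathcal{D}$ with center $E$ and a parabola $\mathcal{P}$ with focus $F$ and directrix $\ell$ form a $4$-Poncelet pair $(\mathcal{D},\mathcal{P})$, and suppose $E\neq F$. Let $f$ be the polar of $F$ with respect to $\mathcal{D}$ and let $L=EF\cap f$. Then $L\in\ell$.
   Context: $(\mathcal{D},\mathcal{P})$ is a $4$-Poncelet pair if there exists a real quadrilateral $ABCD$ (with four distinct vertices, possibly self-intersecting) inscribed in $\mathcal{D}$ (vertices on $\mathcal{D}$) and circumscribed about $\mathcal{P}$ (the lines $AB,BC,CD,DA$ are tangent to $\mathcal{P}$). The polar of $F$ with respect to the circle with center $E$ and radius $R$ is the line $\{X : (X-E)\cdot(F-E)=R^2\}$. *)

theory Defs
  imports "HOL-Analysis.Analysis"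
begin

type_synonym point = "real^2"

definition is_line :: "point set \<Rightarrow> bool" where
  "is_line m \<longleftrightarrow> affine m \<and> aff_dim m = 1"

text \<open>A genuine parabola only if \<open>l\<close> is a line and \<open>F \<notin> l\<close>.\<close>

definition parabola :: "point \<Rightarrow> point set \<Rightarrow> point set" where
  "parabola F l = {X. dist X F = infdist X l}"

text \<open>Tangency is contact, not merely meeting in one point: a line parallel to the axis of a
  parabola meets it exactly once without being tangent. The line is spanned by the nonzero
  velocity, at the point of contact, of a curve running inside \<open>S\<close>.\<close>

definition tangent_line :: "point set \<Rightarrow> point set \<Rightarrow> bool" where
  "tangent_line m S \<longleftrightarrow>
     (\<exists>\<gamma> v. (\<forall>\<^sub>F t in nhds (0::real). \<gamma> t \<in> S) \<and>
            (\<gamma> has_vector_derivative v) (at 0) \<and> v \<noteq> 0 \<and>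
            m = {\<gamma> 0 + s *\<^sub>R v | s. True})"

definition poncelet4 :: "point set \<Rightarrow> point set \<Rightarrow> bool" where
  "poncelet4 K S \<longleftrightarrow>
     (\<exists>A B C D. distinct [A, B, C, D] \<and> {A, B, C, D} \<subseteq> K \<and>
        tangent_line (affine hull {A, B}) S \<and> tangent_line (affine hull {B, C}) S \<and>
        tangent_line (affine hull {C, D}) S \<and> tangent_line (affine hull {D, A}) S)"

text \<open>The polar of \<open>F\<close> with respect to the circle with center \<open>E\<close> and radius \<open>R\<close>.\<close>

definition polar :: "point \<Rightarrow> real \<Rightarrow> point \<Rightarrow> point set" where
  "polar E R F = {X. (X - E) \<bullet> (F - E) = R\<^sup>2}"

end

theory Submission
  imports Defs
begin

text \<open>Take coordinates with origin \<open>F\<close> and first axis orthogonal to \<open>l\<close>, so that \<open>l\<close> is the line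
  \<open>x = 2 * k\<close>. The tangents of the parabola are the lines \<open>k * x + h * y = k\<^sup>2 + h\<^sup>2\<close>, where
  \<open>(k, h)\<close> is the foot of the perpendicular from \<open>F\<close>. The tangents with parameters \<open>s\<close> and \<open>t\<close>
  meet where \<open>y = s + t\<close> and \<open>k * x = k\<^sup>2 - s * t\<close>; that this point lies on the circle is a
  relation which is symmetric in \<open>s\<close>, \<open>t\<close> and quadratic in each. For a Poncelet quadrilateral with
  sides \<open>h1, h2, h3, h4\<close> the quadratics belonging to \<open>s = h1\<close> and to \<open>s = h3\<close> have the same roots
  \<open>h2, h4\<close>. Comparing sums and products of the roots gives a homogeneous linear system for
  \<open>(h1 + h3, h1 * h3 - k\<^sup>2) \<noteq> 0\<close>, whose vanishing determinant is the assertion.\<close>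

text \<open>Quarter turn: for a unit normal \<open>n\<close> of the directrix, \<open>n\<close> and
  \<open>rot n\<close> form the orthonormal frame of the coordinates.\<close>

definition rot :: "point \<Rightarrow> point" where
  "rot n = vector [- n $ 2, n $ 1]"

lemma inner_rot_sum_squares:
  fixes n X :: point
  assumes "norm n = 1"
  shows "(n \<bullet> X)\<^sup>2 + (rot n \<bullet> X)\<^sup>2 = X \<bullet> X"
proof -
  have "n \<bullet> n = 1"
    using assms by (simp add: norm_eq_1)
  moreover have "(n \<bullet> X)\<^sup>2 + (rot n \<bullet> X)\<^sup>2 = (n \<bullet> n) * (X \<bullet> X)"
    by (simp add: rot_def inner_vec_def sum_2 power2_eq_square algebra_simps)
  ultimately show ?thesis
    by simp
qed

lemma is_line_unit_normal:
  assumes "is_line l"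
  obtains n d where "norm n = 1" and "l = {X. n \<bullet> X = d}"
proof -
  have "affine hull l = l"
    using assms by (simp add: is_line_def affine_hull_eq)
  moreover have "aff_dim l = int (DIM(point) - 1)"
    using assms by (simp add: is_line_def)
  then have "\<exists>a b. a \<noteq> 0 \<and> affine hull l = {X. a \<bullet> X = b}"
    by (rule aff_dim_eq_hyperplane[THEN iffD1])
  ultimately obtain a b where a: "a \<noteq> 0" and l: "l = {X. a \<bullet> X = b}"
    by metis
  show thesis
  proof
    show "norm (a /\<^sub>R norm a) = 1"
      using a by simp
    show "l = {X. (a /\<^sub>R norm a) \<bullet> X = b / norm a}"
      unfolding l using a by (simp add: divide_inverse_commute)
  qed
qed

text \<open>The foot \<open>Z\<close> of the perpendicular attains the lower bound that
  Cauchy-Schwarz gives for all points of the hyperplane.\<close>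

lemma infdist_hyperplane:
  fixes n X :: "'a::real_inner"
  assumes "norm n = 1"
  shows "infdist X {Y. n \<bullet> Y = d} = \<bar>n \<bullet> X - d\<bar>"
proof (rule antisym)
  have nn: "n \<bullet> n = 1"
    using assms by (simp add: norm_eq_1)
  define Z where "Z = X - (n \<bullet> X - d) *\<^sub>R n"
  have Z: "Z \<in> {Y. n \<bullet> Y = d}"
    by (simp add: Z_def inner_diff_right nn)
  have "infdist X {Y. n \<bullet> Y = d} \<le> dist X Z"
    using Z by (rule infdist_le)
  also have "dist X Z = \<bar>n \<bullet> X - d\<bar>"
    by (simp add: Z_def dist_norm assms)
  finally show "infdist X {Y. n \<bullet> Y = d} \<le> \<bar>n \<bullet> X - d\<bar>" .
  have ne: "{Y. n \<bullet> Y = d} \<noteq> {}"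
    using Z by blast
  have "\<bar>n \<bullet> X - d\<bar> \<le> dist X Y" if "n \<bullet> Y = d" for Y
    using Cauchy_Schwarz_ineq2[of n "X - Y"] that assms
    by (simp add: inner_diff_right dist_norm)
  then show "\<bar>n \<bullet> X - d\<bar> \<le> infdist X {Y. n \<bullet> Y = d}"
    unfolding infdist_notempty[OF ne] using ne by (intro cINF_greatest) auto
qed

text \<open>Squaring the focus-directrix condition cancels the square of the coordinate along
  \<open>n\<close>.\<close>

lemma mem_parabola_iff:
  assumes n: "norm n = 1" and l: "l = {X. n \<bullet> X = d}"
  shows "X \<in> parabola F l \<longleftrightarrow>
    (rot n \<bullet> (X - F))\<^sup>2 + 2 * (d - n \<bullet> F) * (n \<bullet> (X - F)) = (d - n \<bullet> F)\<^sup>2"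
proof -
  have "X \<in> parabola F l \<longleftrightarrow> norm (X - F) = \<bar>n \<bullet> X - d\<bar>"
    by (simp add: parabola_def l infdist_hyperplane[OF n] dist_norm)
  also have "\<dots> \<longleftrightarrow> (norm (X - F))\<^sup>2 = (n \<bullet> X - d)\<^sup>2"
    using power2_eq_iff_nonneg[OF norm_ge_zero abs_ge_zero, of "X - F" "n \<bullet> X - d"] by auto
  also have "(norm (X - F))\<^sup>2 = (n \<bullet> (X - F))\<^sup>2 + (rot n \<bullet> (X - F))\<^sup>2"
    by (simp add: inner_rot_sum_squares[OF n] power2_norm_eq_inner)
  also have "n \<bullet> X - d = n \<bullet> (X - F) - (d - n \<bullet> F)"
    by (simp add: inner_diff_right)
  finally show ?thesis
    by (simp add: power2_diff) (auto simp: algebra_simps)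
qed

text \<open>Differentiating the equation of the parabola along the curve determines the direction of
  the velocity at the point of contact.\<close>

lemma tangent_line_parabola_equation:
  assumes n: "norm n = 1" and l: "l = {X. n \<bullet> X = d}"
    and "tangent_line m (parabola F l)"
  obtains h where "\<And>X. X \<in> m \<Longrightarrow>
    (d - n \<bullet> F) / 2 * (n \<bullet> (X - F)) + h * (rot n \<bullet> (X - F)) = ((d - n \<bullet> F) / 2)\<^sup>2 + h\<^sup>2"
proof -
  define c where "c = d - n \<bullet> F"
  obtain \<gamma> v where ev: "\<forall>\<^sub>F t in nhds (0::real). \<gamma> t \<in> parabola F l"
    and v: "(\<gamma> has_vector_derivative v) (at 0)" and m: "m = {\<gamma> 0 + s *\<^sub>R v | s. True}"
    using assms(3) unfolding tangent_line_def by blast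
  define x where "x = n \<bullet> (\<gamma> 0 - F)"
  define y where "y = rot n \<bullet> (\<gamma> 0 - F)"
  define g where "g t = (rot n \<bullet> (\<gamma> t - F))\<^sup>2 + 2 * c * (n \<bullet> (\<gamma> t - F))" for t
  have g: "\<forall>\<^sub>F t in nhds 0. g t = c\<^sup>2"
    using ev by eventually_elim (simp add: mem_parabola_iff[OF n l] g_def c_def)
  \<comment> \<open>Every neighbourhood of 0 contains 0, so the point of contact itself lies on the
    parabola.\<close>
  have g0: "y\<^sup>2 + 2 * c * x = c\<^sup>2"
    using eventually_nhds_x_imp_x[OF g] by (simp add: g_def x_def y_def)
  have lin: "((\<lambda>t. u \<bullet> (\<gamma> t - F)) has_real_derivative (u \<bullet> v)) (at 0)" for u
  proof -
    have "((\<lambda>t. u \<bullet> (\<gamma> t - F)) has_vector_derivative (u \<bullet> v)) (at 0)"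
      using v by (auto intro!: derivative_eq_intros
          bounded_linear.has_vector_derivative[OF bounded_linear_inner_right])
    then show ?thesis
      by (simp add: has_real_derivative_iff_has_vector_derivative)
  qed
  have "(g has_real_derivative (2 * y * (rot n \<bullet> v) + 2 * c * (n \<bullet> v))) (at 0)"
    unfolding g_def y_def
    by (rule derivative_eq_intros lin refl)+ (simp add: algebra_simps)
  moreover have "(g has_real_derivative 0) (at 0)"
    using DERIV_cong_ev[OF refl g refl] by simp
  ultimately have dir: "y * (rot n \<bullet> v) + c * (n \<bullet> v) = 0"
    using DERIV_unique by fastforce
  show thesis
  proof
    fix X
    assume "X \<in> m"
    then obtain s where X: "X = \<gamma> 0 + s *\<^sub>R v"
      using m by blast
    have inner: "u \<bullet> (X - F) = u \<bullet> (\<gamma> 0 - F) + s * (u \<bullet> v)" for u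
      by (simp add: X inner_diff_right inner_add_right)
    \<comment> \<open>The parameter is \<open>y / 2\<close>, because the tangent at height
      \<open>y\<close> crosses the tangent at the vertex at half that height.\<close>
    have "c / 2 * (x + s * (n \<bullet> v)) + y / 2 * (y + s * (rot n \<bullet> v))
        = (y\<^sup>2 + c * x) / 2 + s / 2 * (y * (rot n \<bullet> v) + c * (n \<bullet> v))"
      by (simp add: power2_eq_square algebra_simps add_divide_distrib)
    also have "\<dots> = (y\<^sup>2 + c * x) / 2"
      by (simp add: dir)
    also have "\<dots> = (c / 2)\<^sup>2 + (y / 2)\<^sup>2"
      using g0 by (simp add: power_divide)
    finally have "c / 2 * (x + s * (n \<bullet> v)) + y / 2 * (y + s * (rot n \<bullet> v))
        = (c / 2)\<^sup>2 + (y / 2)\<^sup>2" .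
    then show "(d - n \<bullet> F) / 2 * (n \<bullet> (X - F)) + y / 2 * (rot n \<bullet> (X - F))
        = ((d - n \<bullet> F) / 2)\<^sup>2 + (y / 2)\<^sup>2"
      by (simp add: inner x_def y_def c_def)
  qed
qed

text \<open>The center is joined to the midpoint of each chord by a vector parallel to the normal
  \<open>(k, h)\<close> of the line. Subtracting this for two chords with a common end makes the
  third chord parallel to \<open>(k, h)\<close>; lying on the line, it is also orthogonal to
  \<open>(k, h)\<close>, hence zero.\<close>

lemma circle_three_points_not_collinear:
  fixes k h :: real
  assumes "k \<noteq> 0"
    and "k * x1 + h * y1 = w" and "k * x2 + h * y2 = w" and "k * x3 + h * y3 = w"
    and "(x1 - a)\<^sup>2 + (y1 - b)\<^sup>2 = r" and "(x2 - a)\<^sup>2 + (y2 - b)\<^sup>2 = r"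
    and "(x3 - a)\<^sup>2 + (y3 - b)\<^sup>2 = r"
    and "(x1, y1) \<noteq> (x2, y2)" and "(x1, y1) \<noteq> (x3, y3)" and "(x2, y2) \<noteq> (x3, y3)"
  shows False
proof -
  \<comment> \<open>As \<open>k\<close> is nonzero, a point of the line is determined by its second
    coordinate.\<close>
  have ne: "y1 \<noteq> y2" "y1 \<noteq> y3" "y2 \<noteq> y3"
    using assms(1-4,8-10) by (metis add_right_cancel mult_left_cancel)+
  have chord: "k * (y + y' - 2 * b) = h * (x + x' - 2 * a)"
    if "k * x + h * y = w" "k * x' + h * y' = w"
      "(x - a)\<^sup>2 + (y - b)\<^sup>2 = r" "(x' - a)\<^sup>2 + (y' - b)\<^sup>2 = r" "y \<noteq> y'"
    for x y x' y'
  proof -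
    have 1: "k * (x - x') = - h * (y - y')"
      using that(1,2) by (simp add: algebra_simps)
    have 2: "(x - x') * (x + x' - 2 * a) + (y - y') * (y + y' - 2 * b) = 0"
      using that(3,4) by (simp add: power2_eq_square algebra_simps)
    have "(y - y') * (k * (y + y' - 2 * b) - h * (x + x' - 2 * a)) = 0"
      using 1 2 by algebra
    then show ?thesis
      using that(5) by simp
  qed
  have 1: "k * (y1 + y2 - 2 * b) = h * (x1 + x2 - 2 * a)"
    and 2: "k * (y1 + y3 - 2 * b) = h * (x1 + x3 - 2 * a)"
    using chord assms(2-7) ne by blast+
  have 3: "k * (y2 - y3) = h * (x2 - x3)"
    using 1 2 by (simp add: algebra_simps)
  have 4: "k * (x2 - x3) + h * (y2 - y3) = 0"
    using assms(3,4) by (simp add: algebra_simps)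
  have "(k\<^sup>2 + h\<^sup>2) * (y2 - y3) = 0"
    using 3 4 by algebra
  moreover have "k\<^sup>2 + h\<^sup>2 \<noteq> 0"
    using assms(1) by (simp add: sum_power2_eq_zero_iff)
  ultimately show False
    using ne by simp
qed

lemma tangents_meet_on_circle:
  fixes k s t :: real
  assumes k: "k \<noteq> 0" and "s \<noteq> t"
    and s: "k * x + s * y = k\<^sup>2 + s\<^sup>2" and t: "k * x + t * y = k\<^sup>2 + t\<^sup>2"
    and c: "(x - a)\<^sup>2 + (y - b)\<^sup>2 = r"
  shows "(k\<^sup>2 + s\<^sup>2) * (k\<^sup>2 + t\<^sup>2) - 2 * a * k * (k\<^sup>2 - s * t) - 2 * b * k\<^sup>2 * (s + t)
    + k\<^sup>2 * (a\<^sup>2 + b\<^sup>2 - r) = 0"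
proof -
  have "(s - t) * (y - (s + t)) = 0"
    using s t by algebra
  then have y: "y = s + t"
    using \<open>s \<noteq> t\<close> by simp
  have x: "k * x = k\<^sup>2 - s * t"
    using s y by algebra
  \<comment> \<open>Multiply the circle equation by \<open>k\<^sup>2\<close> and substitute; the
    leading factors come from (k^2 - st)^2 + k^2 (s + t)^2 = (k^2 + s^2)(k^2 + t^2).\<close>
  show ?thesis
    using x y c by algebra
qed

text \<open>Here \<open>(a, b)\<close> stands for the center and \<open>q\<close> for the power of
  the focus with respect to the circle. The inverse of the focus is then \<open>(a, b)\<close>
  scaled by q / (a^2 + b^2), so the conclusion puts its first coordinate at \<open>2 * k\<close>, on
  the directrix.\<close>

lemma poncelet_relation:
  fixes k a b q :: real
  defines "G \<equiv> \<lambda>s t. (k\<^sup>2 + s\<^sup>2) * (k\<^sup>2 + t\<^sup>2) - 2 * a * k * (k\<^sup>2 - s * t)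
    - 2 * b * k\<^sup>2 * (s + t) + k\<^sup>2 * q"
  assumes k: "k \<noteq> 0" and ne: "h1 \<noteq> h3" "h2 \<noteq> h4"
    and G: "G h1 h2 = 0" "G h2 h3 = 0" "G h3 h4 = 0" "G h4 h1 = 0"
  shows "a * q = 2 * k * (a\<^sup>2 + b\<^sup>2)"
proof -
  define S where "S = h2 + h4"
  define P where "P = h2 * h4"
  \<comment> \<open>Vieta's formulas for the quadratic \<open>G s\<close> in its second argument,
    whose leading coefficient is \<open>k\<^sup>2 + s\<^sup>2\<close>.\<close>
  have sum: "(k\<^sup>2 + s\<^sup>2) * S = 2 * b * k\<^sup>2 - 2 * a * k * s"
    and prod: "(k\<^sup>2 + s\<^sup>2) * P = k\<^sup>2 * (k\<^sup>2 + s\<^sup>2) - 2 * a * k^3 - 2 * b * k\<^sup>2 * s + k\<^sup>2 * q"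
    if "G s h2 = 0" "G s h4 = 0" for s
  proof -
    have "(h2 - h4) * ((k\<^sup>2 + s\<^sup>2) * S - (2 * b * k\<^sup>2 - 2 * a * k * s)) = 0"
      using that unfolding G_def S_def by algebra
    then show sum: "(k\<^sup>2 + s\<^sup>2) * S = 2 * b * k\<^sup>2 - 2 * a * k * s"
      using ne by simp
    show "(k\<^sup>2 + s\<^sup>2) * P = k\<^sup>2 * (k\<^sup>2 + s\<^sup>2) - 2 * a * k^3 - 2 * b * k\<^sup>2 * s + k\<^sup>2 * q"
      using that sum unfolding G_def S_def P_def by algebra
  qed
  have G_commute: "G s t = G t s" for s t
    by (simp add: G_def algebra_simps)
  have at1: "G h1 h2 = 0" "G h1 h4 = 0" and at3: "G h3 h2 = 0" "G h3 h4 = 0"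
    using G G_commute by metis+
  define u where "u = h1 + h3"
  define w where "w = h1 * h3 - k\<^sup>2"
  \<comment> \<open>Eliminating \<open>S\<close> between \<open>s = h1\<close> and
    \<open>s = h3\<close> leaves a multiple of \<open>h1 - h3\<close>; the same happens below with
    \<open>P\<close>.\<close>
  have "2 * k * (h1 - h3) * (b * k * u - a * w) = 0"
    using sum[OF at1] sum[OF at3] unfolding u_def w_def by algebra
  then have 1: "b * k * u = a * w"
    using k ne by simp
  have "k\<^sup>2 * (h1 - h3) * ((q - 2 * a * k) * u - 2 * b * w) = 0"
    using prod[OF at1] prod[OF at3] unfolding u_def w_def by algebra
  then have 2: "(q - 2 * a * k) * u = 2 * b * w"
    using k ne by simp
  \<comment> \<open>Cramer's rule: the determinant of the system \<open>1\<close>, \<open>2\<close>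
    annihilates both unknowns.\<close>
  have "u * (a * q - 2 * k * (a\<^sup>2 + b\<^sup>2)) = 0" "w * (a * q - 2 * k * (a\<^sup>2 + b\<^sup>2)) = 0"
    using 1 2 by algebra+
  moreover have "w \<noteq> 0" if "u = 0"
  proof -
    have "w = - (h1\<^sup>2 + k\<^sup>2)"
      using that unfolding u_def w_def by algebra
    then show ?thesis
      using k by (metis neg_equal_0_iff_equal sum_power2_eq_zero_iff)
  qed
  ultimately show ?thesis
    by auto
qed

theorem theorem4p6:
  fixes E F :: point and R :: real and l :: "point set"
  assumes "R > 0"
    and "is_line l" and "F \<notin> l"
    and "poncelet4 (sphere E R) (parabola F l)"
    and "E \<noteq> F"
  shows "\<exists>L. affine hull {E, F} \<inter> polar E R F = {L} \<and> L \<in> l"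
proof -
  obtain n d where n: "norm n = 1" and l: "l = {X. n \<bullet> X = d}"
    using is_line_unit_normal[OF assms(2)] .
  define k where "k = (d - n \<bullet> F) / 2"
  have k: "k \<noteq> 0"
    using assms(3) by (simp add: k_def l)
  define x where "x X = n \<bullet> (X - F)" for X
  define y where "y X = rot n \<bullet> (X - F)" for X
  have norm_xy: "(x X - x Y)\<^sup>2 + (y X - y Y)\<^sup>2 = (X - Y) \<bullet> (X - Y)" for X Y
    using inner_rot_sum_squares[OF n, of "X - Y"] by (simp add: x_def y_def inner_diff_right)
  have xy_inj: "(x X, y X) \<noteq> (x Y, y Y)" if "X \<noteq> Y" for X Y
    using norm_xy[of X Y] that by auto
  have circ: "(x X - x E)\<^sup>2 + (y X - y E)\<^sup>2 = R\<^sup>2" if "X \<in> sphere E R" for X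
    using that by (simp add: norm_xy dist_norm norm_minus_commute flip: power2_norm_eq_inner)
  have tangent: "\<exists>h. \<forall>X\<in>m. k * x X + h * y X = k\<^sup>2 + h\<^sup>2"
    if "tangent_line m (parabola F l)" for m
    using tangent_line_parabola_equation[OF n l that] unfolding k_def x_def y_def by metis
  obtain A B C D where dist: "distinct [A, B, C, D]" and on: "{A, B, C, D} \<subseteq> sphere E R"
    and tl: "tangent_line (affine hull {A, B}) (parabola F l)"
      "tangent_line (affine hull {B, C}) (parabola F l)"
      "tangent_line (affine hull {C, D}) (parabola F l)"
      "tangent_line (affine hull {D, A}) (parabola F l)"
    using assms(4) unfolding poncelet4_def by blast
  have side: "\<exists>h. k * x X + h * y X = k\<^sup>2 + h\<^sup>2 \<and> k * x Y + h * y Y = k\<^sup>2 + h\<^sup>2"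
    if "tangent_line (affine hull {X, Y}) (parabola F l)" for X Y
    using tangent[OF that] hull_subset[of "{X, Y}" affine] by blast
  obtain h1 where h1: "k * x A + h1 * y A = k\<^sup>2 + h1\<^sup>2" "k * x B + h1 * y B = k\<^sup>2 + h1\<^sup>2"
    using side[OF tl(1)] by blast
  obtain h2 where h2: "k * x B + h2 * y B = k\<^sup>2 + h2\<^sup>2" "k * x C + h2 * y C = k\<^sup>2 + h2\<^sup>2"
    using side[OF tl(2)] by blast
  obtain h3 where h3: "k * x C + h3 * y C = k\<^sup>2 + h3\<^sup>2" "k * x D + h3 * y D = k\<^sup>2 + h3\<^sup>2"
    using side[OF tl(3)] by blast
  obtain h4 where h4: "k * x D + h4 * y D = k\<^sup>2 + h4\<^sup>2" "k * x A + h4 * y A = k\<^sup>2 + h4\<^sup>2"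
    using side[OF tl(4)] by blast
  have on': "A \<in> sphere E R" "B \<in> sphere E R" "C \<in> sphere E R" "D \<in> sphere E R"
    using on by (simp_all only: insert_subset)
  have dist': "A \<noteq> B" "A \<noteq> C" "A \<noteq> D" "B \<noteq> C" "B \<noteq> D" "C \<noteq> D"
    using dist by simp_all
  have no3: False
    if "k * x X + h * y X = w" "k * x Y + h * y Y = w" "k * x Z + h * y Z = w"
      "X \<in> sphere E R" "Y \<in> sphere E R" "Z \<in> sphere E R" "X \<noteq> Y" "X \<noteq> Z" "Y \<noteq> Z"
    for X Y Z h w
    using circle_three_points_not_collinear[OF k that(1-3) that(4-6)[THEN circ]
        that(7-9)[THEN xy_inj]] .
  \<comment> \<open>Two sides with equal parameters would lie on one line, which would then contain
    three vertices. Adjacent sides must differ in order to meet in a single point, opposite ones to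
    give two distinct roots.\<close>
  have ne: "h1 \<noteq> h2" "h2 \<noteq> h3" "h3 \<noteq> h4" "h4 \<noteq> h1" "h1 \<noteq> h3" "h2 \<noteq> h4"
  proof -
    show "h1 \<noteq> h2"
      using no3[OF h1 _ on'(1,2,3) dist'(1,2,4)] h2(2) by metis
    show "h2 \<noteq> h3"
      using no3[OF h2 _ on'(2,3,4) dist'(4,5,6)] h3(2) by metis
    show "h3 \<noteq> h4"
      using no3[OF _ h3 on'(1,3,4) dist'(2,3,6)] h4(2) by metis
    show "h4 \<noteq> h1"
      using no3[OF h1 _ on'(1,2,4) dist'(1,3,5)] h4(1) by metis
    show "h1 \<noteq> h3"
      using no3[OF h1 _ on'(1,2,3) dist'(1,2,4)] h3(1) by metis
    show "h2 \<noteq> h4"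
      using no3[OF h2 _ on'(2,3,4) dist'(4,5,6)] h4(1) by metis
  qed
  define q where "q = (x E)\<^sup>2 + (y E)\<^sup>2 - R\<^sup>2"
  have "x E * q = 2 * k * ((x E)\<^sup>2 + (y E)\<^sup>2)"
    unfolding q_def
    by (rule poncelet_relation[OF k ne(5,6)
          tangents_meet_on_circle[OF k ne(1) h1(2) h2(1) circ[OF on'(2)]]
          tangents_meet_on_circle[OF k ne(2) h2(2) h3(1) circ[OF on'(3)]]
          tangents_meet_on_circle[OF k ne(3) h3(2) h4(1) circ[OF on'(4)]]
          tangents_meet_on_circle[OF k ne(4) h4(2) h1(1) circ[OF on'(1)]]])
  moreover define N where "N = (F - E) \<bullet> (F - E)"
  have "(x E)\<^sup>2 + (y E)\<^sup>2 = N"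
    using norm_xy[of F E] by (simp add: N_def x_def y_def)
  ultimately have rel: "x E * (N - R\<^sup>2) = 2 * k * N"
    by (simp add: q_def)
  have N: "N \<noteq> 0"
    using assms(5) by (simp add: N_def)
  \<comment> \<open>The inverse of \<open>F\<close> in the circle.\<close>
  define L where "L = E + (R\<^sup>2 / N) *\<^sub>R (F - E)"
  have hull: "affine hull {E, F} = range (\<lambda>t. E + t *\<^sub>R (F - E))"
    by (simp add: affine_hull_2_alt)
  have pol: "E + t *\<^sub>R (F - E) \<in> polar E R F \<longleftrightarrow> t = R\<^sup>2 / N" for t
    using N by (simp add: polar_def eq_divide_eq flip: N_def)
  have "affine hull {E, F} \<inter> polar E R F = {L}"
    unfolding hull L_def using pol by auto
  \<comment> \<open>By \<open>rel\<close>, the component of \<open>L - F\<close> along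
    \<open>n\<close> is \<open>2 * k\<close>, the signed distance from \<open>F\<close> to the
    directrix.\<close>
  moreover have "n \<bullet> L = n \<bullet> F + x E - R\<^sup>2 / N * x E"
    by (simp add: L_def x_def inner_add_right inner_diff_right right_diff_distrib)
  then have "n \<bullet> L = n \<bullet> F + x E * (N - R\<^sup>2) / N"
    using N by (simp add: right_diff_distrib diff_divide_distrib)
  then have "n \<bullet> L = d"
    unfolding rel using N by (simp add: k_def diff_divide_distrib)
  then have "L \<in> l"
    by (simp add: l)
  ultimately show ?thesis
    by blast
qed

end
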